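(* Let $N\ge 2$ be an integer and let $a<b$ be real numbers. Assume that for every bounded $C^\infty$ function $\varphi$ on $\mathbb{R}$ the functional $\Psi(x)=\mathbb{E}_x\big(\varphi(X_{\tau_{ab}})\mathbf{1}_{\{\tau_{ab}<+\infty\}}\big)$, $x\in(a,b)$ (defined in the context), solves the boundary value problem $\Psi^{(2N)}(x)=0$ for $x\in(a,b)$, $\Psi^{(k)}(a)=\varphi^{(k)}(a)$ and $\Psi^{(k)}(b)=\varphi^{(k)}(b)$ for $0\le k\le N-1$. Then, for $x\in(a,b)$, the "ruin" pseudo-probabilities related to pseudo-Brownian motion are given by $$\mathbb{P}_x\{\tau_a^-<\tau_b^+\}=H_0^-(x),\qquad\mathbb{P}_x\{\tau_b^+<\tau_a^-\}=H_0^+(x),$$ where $$H_0^-(x)=\Big(\frac{b-x}{b-a}\Big)^{N}\sum_{\ell=0}^{N-1}\binom{\ell+N-1}{\ell}\Big(\frac{x-a}{b-a}\Big)^{\ell},\qquad H_0^+(x)=\Big(\frac{x-a}{b-a}\Big)^{N}\sum_{\ell=0}^{N-1}\binom{\ell+N-1}{\ell}\Big(\frac{b-x}{b-a}\Big)^{\ell}.$$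
   Context: Pseudo-process. For $t>0$, $p(t;\cdot)$ is the function with $\int_{-\infty}^{+\infty}\mathrm{e}^{\mathrm{i}ux}p(t;x)\,\mathrm{d}x=\mathrm{e}^{-tu^{2N}}$ (a signed kernel), and $p(t;x,y)=p(t;x-y)$. The pseudo-process (pseudo-Brownian motion) $(X_t)_{t\ge0}$ started at $x$ has the signed finite-dimensional distributions $\mathbb{P}_x\{X_{t_1}\in\mathrm{d}x_1,\dots,X_{t_n}\in\mathrm{d}x_n\}=\prod_{k=1}^n p(t_k-t_{k-1};x_{k-1},x_k)\,\mathrm{d}x_1\cdots\mathrm{d}x_n$ for $0=t_0<t_1<\dots<t_n$, $x_0=x$. Functional. $\tau_{ab}=\inf\{t\ge0:X_t\notin(a,b)\}$ is approximated by $\tau_{ab,n}=2^{-n}\min\{k\in\mathbb{N}:X_{k/2^n}\notin(a,b)\}$. For $x\in(a,b)$, $$\Psi_n(x)=\mathbb{E}_x\big(\varphi(X_{\tau_{ab,n}})\mathbf{1}_{\{\tau_{ab,n}<+\infty\}}\big)=\sum_{k\ge1}\int_{(a,b)^{k-1}\times(\mathbb{R}\setminus(a,b))}\varphi(x_k)\prod_{j=1}^k p(2^{-n};x_{j-1},x_j)\,\mathrm{d}x_1\cdots\mathrm{d}x_k\quad(x_0=x),$$ and by definition $\mathbb{E}_x\big(\varphi(X_{\tau_{ab}})\mathbf{1}_{\{\tau_{ab}<+\infty\}}\big)=\Psi(x)=\lim_{n\to\infty}\Psi_n(x)$ (the limit being assumed to exist). Values of $\Psi$ and its derivatives at $a$,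 $b$ are one-sided limits from inside $(a,b)$. Ruin pseudo-probabilities. $\tau_a^-=\inf\{t\ge0:X_t<a\}$ and $\tau_b^+=\inf\{t\ge0:X_t>b\}$. The pseudo-probability $\mathbb{P}_x\{\tau_a^-<\tau_b^+\}$ means $\mathbb{P}_x\{X_{\tau_{ab}}\le a\}$, i.e. $\mathbb{E}_x(\varphi(X_{\tau_{ab}})\mathbf{1}_{\{\tau_{ab}<+\infty\}})$ for any $C^\infty$ function $\varphi$ equal to $1$ on a neighbourhood of $(-\infty,a]$ and to $0$ on a neighbourhood of $[b,+\infty)$; likewise $\mathbb{P}_x\{\tau_b^+<\tau_a^-\}$ means $\mathbb{P}_x\{X_{\tau_{ab}}\ge b\}$, i.e. $\mathbb{E}_x(\varphi(X_{\tau_{ab}})\mathbf{1}_{\{\tau_{ab}<+\infty\}})$ for any $C^\infty$ function $\varphi$ equal to $0$ on a neighbourhood of $(-\infty,a]$ and to $1$ on a neighbourhood of $[b,+\infty)$. *)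

theory Defs
  imports "HOL-Analysis.Analysis"
begin

text \<open>The (signed) transition kernel of pseudo-Brownian motion, characterised by its Fourier
  transform. This fixes each \<open>p t\<close> up to a Lebesgue null set, so the integrals
  below do not depend on the chosen version.\<close>

definition pseudo_brownian_kernel :: "nat \<Rightarrow> (real \<Rightarrow> real \<Rightarrow> real) \<Rightarrow> bool" where
  "pseudo_brownian_kernel N p \<longleftrightarrow>
     (\<forall>t>0. integrable lborel (p t) \<and>
        (\<forall>u. (LINT x|lborel. exp (\<i> * complex_of_real (u * x)) * complex_of_real (p t x))
               = complex_of_real (exp (- t * u ^ (2 * N)))))"

text \<open>The contribution of the event that the process sampled at the times \<open>j / 2^n\<close>
  first leaves \<open>(a, b)\<close> at step \<open>k\<close>. A path is a function on \<open>{1..k}\<close>; the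
  update at \<open>0\<close> inserts the starting point.\<close>

definition exit_term ::
  "(real \<Rightarrow> real \<Rightarrow> real) \<Rightarrow> real \<Rightarrow> real \<Rightarrow> (real \<Rightarrow> real) \<Rightarrow> real \<Rightarrow> nat \<Rightarrow> nat \<Rightarrow> real" where
  "exit_term p a b \<phi> x n k =
     (LINT X : (\<Pi>\<^sub>E j\<in>{1..k}. if j < k then {a<..<b} else - {a<..<b})
             | (\<Pi>\<^sub>M j\<in>{1..k}. lborel).
        \<phi> (X k) * (\<Prod>j=1..k. p (1 / 2 ^ n) ((X(0 := x)) (j - 1) - (X(0 := x)) j)))"

text \<open>The expectation of \<open>\<phi>\<close> at the exit place from \<open>(a, b)\<close>, started at \<open>x\<close>, exists
  and equals \<open>L\<close>: the discretised expectations are convergent series (over the exit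
  steps \<open>k \<ge> 1\<close>), and these converge to \<open>L\<close> as the mesh \<open>1 / 2^n\<close> tends to \<open>0\<close>.\<close>

definition has_exit_expectation ::
  "(real \<Rightarrow> real \<Rightarrow> real) \<Rightarrow> real \<Rightarrow> real \<Rightarrow> (real \<Rightarrow> real) \<Rightarrow> real \<Rightarrow> real \<Rightarrow> bool" where
  "has_exit_expectation p a b \<phi> x L \<longleftrightarrow>
     (\<exists>\<Psi>. (\<forall>n. (\<lambda>m. exit_term p a b \<phi> x n (Suc m)) sums \<Psi> n) \<and> \<Psi> \<longlonglongrightarrow> L)"

definition smooth_fun :: "(real \<Rightarrow> real) \<Rightarrow> bool" where
  "smooth_fun f \<longleftrightarrow> (\<forall>k x. (deriv ^^ k) f field_differentiable (at x))"

text \<open>The differentiability clause is explicit because \<open>deriv\<close> is total. Boundary values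
  are limits from inside \<open>(a, b)\<close>.\<close>

definition solves_exit_bvp ::
  "nat \<Rightarrow> real \<Rightarrow> real \<Rightarrow> (real \<Rightarrow> real) \<Rightarrow> (real \<Rightarrow> real) \<Rightarrow> bool" where
  "solves_exit_bvp N a b \<phi> \<Psi> \<longleftrightarrow>
     (\<forall>k<2 * N. \<forall>x\<in>{a<..<b}. (deriv ^^ k) \<Psi> field_differentiable (at x)) \<and>
     (\<forall>x\<in>{a<..<b}. (deriv ^^ (2 * N)) \<Psi> x = 0) \<and>
     (\<forall>k\<le>N - 1. ((deriv ^^ k) \<Psi> \<longlongrightarrow> (deriv ^^ k) \<phi> a) (at_right a)) \<and>
     (\<forall>k\<le>N - 1. ((deriv ^^ k) \<Psi> \<longlongrightarrow> (deriv ^^ k) \<phi> b) (at_left b))"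

definition smooth_cutoff :: "real \<Rightarrow> real \<Rightarrow> real \<Rightarrow> real \<Rightarrow> (real \<Rightarrow> real) \<Rightarrow> bool" where
  "smooth_cutoff a b c d \<phi> \<longleftrightarrow> smooth_fun \<phi> \<and>
     (\<exists>U. open U \<and> {..a} \<subseteq> U \<and> (\<forall>x\<in>U. \<phi> x = c)) \<and>
     (\<exists>V. open V \<and> {b..} \<subseteq> V \<and> (\<forall>x\<in>V. \<phi> x = d))"

text \<open>\<open>q\<close> is the pseudo-probability, started at \<open>x\<close>, of leaving \<open>(a, b)\<close> on the
  left (\<open>\<tau>\<^sub>a\<^sup>- < \<tau>\<^sub>b\<^sup>+\<close>), respectively on the right (\<open>\<tau>\<^sub>b\<^sup>+ < \<tau>\<^sub>a\<^sup>-\<close>).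
  The first conjunct excludes vacuity, so that \<open>q\<close> is uniquely determined.\<close>

definition has_lower_ruin_prob ::
  "(real \<Rightarrow> real \<Rightarrow> real) \<Rightarrow> real \<Rightarrow> real \<Rightarrow> real \<Rightarrow> real \<Rightarrow> bool" where
  "has_lower_ruin_prob p a b x q \<longleftrightarrow>
     (\<exists>\<phi>. smooth_cutoff a b 1 0 \<phi>) \<and>
     (\<forall>\<phi>. smooth_cutoff a b 1 0 \<phi> \<longrightarrow> has_exit_expectation p a b \<phi> x q)"

definition has_upper_ruin_prob ::
  "(real \<Rightarrow> real \<Rightarrow> real) \<Rightarrow> real \<Rightarrow> real \<Rightarrow> real \<Rightarrow> real \<Rightarrow> bool" where
  "has_upper_ruin_prob p a b x q \<longleftrightarrow>
     (\<exists>\<phi>. smooth_cutoff a b 0 1 \<phi>) \<and>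
     (\<forall>\<phi>. smooth_cutoff a b 0 1 \<phi> \<longrightarrow> has_exit_expectation p a b \<phi> x q)"

definition H0_minus :: "nat \<Rightarrow> real \<Rightarrow> real \<Rightarrow> real \<Rightarrow> real" where
  "H0_minus N a b x = ((b - x) / (b - a)) ^ N *
     (\<Sum>l=0..N - 1. real ((l + N - 1) choose l) * ((x - a) / (b - a)) ^ l)"

definition H0_plus :: "nat \<Rightarrow> real \<Rightarrow> real \<Rightarrow> real \<Rightarrow> real" where
  "H0_plus N a b x = ((x - a) / (b - a)) ^ N *
     (\<Sum>l=0..N - 1. real ((l + N - 1) choose l) * ((b - x) / (b - a)) ^ l)"

end

theory Submission
  imports Defs
begin

text \<open>The hypothesis turns the probabilistic question into a two-point Hermite interpolation
  problem. Let \<open>\<phi>\<close> be a smooth cutoff, constantly \<open>c\<close> near \<open>{..a}\<close> and \<open>d\<close> near \<open>{b..}\<close>. It is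
  bounded, so its exit expectation \<open>\<Psi>\<close> solves the boundary value problem. Since \<open>\<Psi>\<close> has
  vanishing derivative of order \<open>2 * N\<close>, Taylor's formula makes it a polynomial of degree less
  than \<open>2 * N\<close> on \<open>{a<..<b}\<close> (\<open>polynomial_if_higher_deriv_zero\<close>); the boundary conditions say that
  \<open>\<Psi> - c\<close> vanishes to order \<open>N\<close> at \<open>a\<close> and \<open>\<Psi> - d\<close> vanishes to order \<open>N\<close> at \<open>b\<close>. Two such
  polynomials differ by a multiple of \<open>(X - a) ^ N * (X - b) ^ N\<close>, whose degree is \<open>2 * N\<close>, hence
  they agree (\<open>two_point_hermite_unique\<close>).

  It remains to recognise \<open>c * H\<^sup>- + d * H\<^sup>+\<close> as an interpolant. By construction \<open>H\<^sup>-\<close>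
  vanishes to order \<open>N\<close> at \<open>b\<close> and \<open>H\<^sup>+\<close> to order \<open>N\<close> at \<open>a\<close>, so everything follows from
  \<open>H\<^sup>- + H\<^sup>+ = 1\<close>. That identity is Banach's matchbox problem in disguise: in a sequence of
  coin tosses with success probability \<open>t\<close>, either \<open>N\<close> failures or \<open>N\<close> successes come first
  (\<open>matchbox_identity\<close>).

  The ruin probabilities also require that cutoffs exist; these are built from
  \<open>exp (- 1 / x)\<close> in the usual way.\<close>

section \<open>Smooth cutoffs\<close>

text \<open>Smoothness of \<open>exp (- 1 / x)\<close> is best proved for the whole family with factors
  \<open>x\<close> to the power \<open>- n\<close>, because differentiation maps the linear span of the family to itself.\<close>

definition flat :: "nat \<Rightarrow> real \<Rightarrow> real" where
  "flat n x = (if x > 0 then inverse x ^ n * exp (- inverse x) else 0)"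

lemma flat_tendsto_0: "(flat n \<longlongrightarrow> 0) (at 0)"
proof -
  have l: "(flat n \<longlongrightarrow> 0) (at_left 0)"
    by (rule tendsto_eventually) (auto simp: flat_def eventually_at_filter)
  have "((\<lambda>x::real. inverse x ^ n / exp (inverse x)) \<longlongrightarrow> 0) (at_right 0)"
    by (rule filterlim_compose[OF tendsto_power_div_exp_0 filterlim_inverse_at_top_right])
  then have r: "(flat n \<longlongrightarrow> 0) (at_right 0)"
    by (rule Lim_transform_eventually)
      (auto simp: flat_def eventually_at_filter exp_minus divide_inverse)
  show ?thesis
    using l r by (simp add: filterlim_split_at)
qed

lemma flat_has_derivative:
  "(flat n has_real_derivative (flat (n + 2) x - real n * flat (Suc n) x)) (at x)"
proof -
  consider "x < 0" | "x = 0" | "x > 0" by linarith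
  then show ?thesis
  proof cases
    case 1
    have "((\<lambda>x. 0) has_real_derivative 0) (at x)" by simp
    then have "(flat n has_real_derivative 0) (at x)"
      by (rule has_field_derivative_transform_within_open[where S = "{..<0}"])
        (use 1 in \<open>auto simp: flat_def\<close>)
    then show ?thesis using 1 by (simp add: flat_def)
  next
    case 2
    \<comment> \<open>The difference quotient of \<open>flat n\<close> at \<open>0\<close> is \<open>flat (Suc n)\<close>.\<close>
    have "((\<lambda>y. (flat n y - flat n 0) / (y - 0)) \<longlongrightarrow> 0) (at 0)"
      by (rule Lim_transform_eventually[OF flat_tendsto_0[of "Suc n"]])
        (auto simp: flat_def eventually_at_filter field_simps)
    then show ?thesis
      using 2 by (simp add: flat_def has_field_derivative_iff)
  next
    case 3
    have "((\<lambda>x. inverse x ^ n * exp (- inverse x)) has_real_derivative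
        (flat (n + 2) x - real n * flat (Suc n) x)) (at x)"
    proof -
      have inv: "(inverse has_real_derivative - (inverse x ^ 2)) (at x)"
        using DERIV_inverse[of x] 3 by (simp add: power2_eq_square)
      show ?thesis
        by (rule DERIV_cong[OF DERIV_mult[OF DERIV_power[OF inv]
                DERIV_chain2[OF DERIV_exp DERIV_minus[OF inv]]]])
          (use 3 in \<open>cases n; simp add: flat_def algebra_simps power2_eq_square\<close>)
    qed
    then show ?thesis
      by (rule has_field_derivative_transform_within_open[where S = "{0<..}"])
        (use 3 in \<open>auto simp: flat_def\<close>)
  qed
qed

text \<open>A class of functions that contains the derivatives of its members consists of smooth
  functions, so it suffices to generate one that contains the cutoffs. Closure under inverses
  is what the usual quotient construction needs.\<close>

inductive_set flat_class :: "(real \<Rightarrow> real) set" where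
  const: "(\<lambda>x. c) \<in> flat_class"
| flat: "(\<lambda>x. flat n (u * x + v)) \<in> flat_class"
| add: "f \<in> flat_class \<Longrightarrow> g \<in> flat_class \<Longrightarrow> (\<lambda>x. f x + g x) \<in> flat_class"
| mult: "f \<in> flat_class \<Longrightarrow> g \<in> flat_class \<Longrightarrow> (\<lambda>x. f x * g x) \<in> flat_class"
| inverse: "f \<in> flat_class \<Longrightarrow> (\<And>x. f x \<noteq> 0) \<Longrightarrow> (\<lambda>x. inverse (f x)) \<in> flat_class"

lemma flat_class_closed_derivative:
  assumes "f \<in> flat_class"
  shows "\<exists>g\<in>flat_class. \<forall>x. (f has_real_derivative g x) (at x)"
  using assms
proof induction
  case (const c)
  then show ?case by (intro bexI[OF _ flat_class.const[of 0]]) simp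
next
  case (flat n u v)
  let ?g = "\<lambda>x. u * (flat (n + 2) (u * x + v) + (- real n) * flat (Suc n) (u * x + v))"
  have g: "?g \<in> flat_class" by (intro flat_class.intros)
  have "((\<lambda>x. flat n (u * x + v)) has_real_derivative ?g x) (at x)" for x
    by (rule DERIV_cong[OF DERIV_chain2[OF flat_has_derivative]])
      (auto intro!: derivative_eq_intros simp: algebra_simps)
  then show ?case by (intro bexI[OF _ g] allI)
next
  case (add f g)
  then obtain f' g' where *: "f' \<in> flat_class" "g' \<in> flat_class"
    "\<forall>x. (f has_real_derivative f' x) (at x)" "\<forall>x. (g has_real_derivative g' x) (at x)"
    by blast
  then show ?case
    by (intro bexI[of _ "\<lambda>x. f' x + g' x"]) (auto intro!: flat_class.add DERIV_add)
next
  case (mult f g)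
  then obtain f' g' where *: "f' \<in> flat_class" "g' \<in> flat_class"
    "\<forall>x. (f has_real_derivative f' x) (at x)" "\<forall>x. (g has_real_derivative g' x) (at x)"
    by blast
  have "(\<lambda>x. f' x * g x + g' x * f x) \<in> flat_class"
    using * mult by (intro flat_class.intros)
  then show ?case
    using * by (intro bexI[of _ "\<lambda>x. f' x * g x + g' x * f x"]) (auto intro: DERIV_mult)
next
  case (inverse f)
  then obtain f' where *: "f' \<in> flat_class" "\<forall>x. (f has_real_derivative f' x) (at x)"
    by blast
  let ?g = "\<lambda>x. (-1) * (inverse (f x) * f' x * inverse (f x))"
  have g: "?g \<in> flat_class"
    using * inverse.hyps by (intro flat_class.intros)
  have "((\<lambda>x. inverse (f x)) has_real_derivative ?g x) (at x)" for x
    using DERIV_inverse'[OF *(2)[rule_format] inverse.hyps(2)] by simp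
  then show ?case by (intro bexI[OF _ g] allI)
qed

lemma flat_class_smooth:
  assumes "f \<in> flat_class"
  shows "smooth_fun f"
proof -
  have "(deriv ^^ k) f \<in> flat_class" for k
  proof (induction k)
    case (Suc k)
    then obtain g where "g \<in> flat_class" "\<forall>x. ((deriv ^^ k) f has_real_derivative g x) (at x)"
      using flat_class_closed_derivative by blast
    then have "deriv ((deriv ^^ k) f) = g" by (auto intro: DERIV_imp_deriv)
    with \<open>g \<in> flat_class\<close> show ?case by simp
  qed (use assms in simp)
  then show ?thesis
    unfolding smooth_fun_def field_differentiable_def
    using flat_class_closed_derivative by blast
qed

lemma smooth_cutoff_exists:
  assumes "a < b"
  shows "\<exists>\<phi>. smooth_cutoff a b c d \<phi>"
proof -
  define s t where "s = (2 * a + b) / 3" and "t = (a + 2 * b) / 3"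
  have st: "a < s" "s < t" "t < b" using assms by (auto simp: s_def t_def)
  \<comment> \<open>The arguments are spelled out as instances of \<open>u * x + v\<close> for the rule \<open>flat_class.flat\<close>.\<close>
  let ?u = "\<lambda>x. flat 0 (1 * x + (- s))" and ?v = "\<lambda>x. flat 0 ((- 1) * x + t)"
  have pos: "?u x + ?v x \<noteq> 0" for x
  proof -
    have "?u x \<ge> 0" "?v x \<ge> 0" by (auto simp: flat_def)
    moreover have "?u x > 0 \<or> ?v x > 0" using st by (auto simp: flat_def)
    ultimately show ?thesis by linarith
  qed
  let ?f = "\<lambda>x. c + (d - c) * (?u x * inverse (?u x + ?v x))"
  have u: "?u \<in> flat_class" and v: "?v \<in> flat_class" by (rule flat_class.flat)+
  have "(\<lambda>x. inverse (?u x + ?v x)) \<in> flat_class"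
    by (rule flat_class.inverse[OF flat_class.add[OF u v] pos])
  then have "?f \<in> flat_class"
    by (rule flat_class.add[OF flat_class.const flat_class.mult[OF flat_class.const
          flat_class.mult[OF u]]])
  then have "smooth_fun ?f" by (rule flat_class_smooth)
  moreover have "\<forall>x\<in>{..<s}. ?f x = c" by (auto simp: flat_def)
  moreover have "\<forall>x\<in>{t<..}. ?f x = d"
    using st by (auto simp: flat_def)
  moreover have "{..a} \<subseteq> {..<s}" "{b..} \<subseteq> {t<..}" using st by auto
  ultimately have "smooth_cutoff a b c d ?f"
    unfolding smooth_cutoff_def
    by (intro conjI exI[of _ "{..<s}"] exI[of _ "{t<..}"] open_lessThan open_greaterThan)
  then show ?thesis by blast
qed

lemma smooth_cutoff_bounded:
  assumes "smooth_cutoff a b c d \<phi>"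
  shows "bounded (range \<phi>)"
proof -
  have "\<phi> field_differentiable (at x)" for x
    using assms unfolding smooth_cutoff_def smooth_fun_def by (metis funpow_0)
  then have "continuous_on {a..b} \<phi>"
    by (simp add: continuous_at_imp_continuous_on field_differentiable_imp_continuous_at)
  then have "bounded (\<phi> ` {a..b})"
    by (intro compact_imp_bounded compact_continuous_image) auto
  moreover have "range \<phi> \<subseteq> insert c (insert d (\<phi> ` {a..b}))"
  proof
    fix y assume "y \<in> range \<phi>"
    then obtain x where x: "y = \<phi> x" by blast
    have "x \<in> {..a} \<or> x \<in> {b..} \<or> x \<in> {a..b}" by auto
    with assms x show "y \<in> insert c (insert d (\<phi> ` {a..b}))"
      unfolding smooth_cutoff_def by blast
  qed
  ultimately show ?thesis by (meson bounded_insert bounded_subset)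
qed

section \<open>Two-point Hermite interpolation\<close>

lemma higher_deriv_eq_poly:
  fixes f :: "real \<Rightarrow> real"
  assumes "open S" and "\<And>x. x \<in> S \<Longrightarrow> f x = poly P x" and "x \<in> S"
  shows "(deriv ^^ k) f x = poly ((pderiv ^^ k) P) x"
  using \<open>x \<in> S\<close>
proof (induction k arbitrary: x)
  case (Suc k)
  have "(poly ((pderiv ^^ k) P) has_real_derivative poly ((pderiv ^^ Suc k) P) x) (at x)"
    by (simp add: poly_DERIV)
  then have "((deriv ^^ k) f has_real_derivative poly ((pderiv ^^ Suc k) P) x) (at x)"
    by (rule has_field_derivative_transform_within_open[OF _ \<open>open S\<close>])
      (use Suc in auto)
  then show ?case by (simp add: DERIV_imp_deriv)
qed (use assms in simp)

text \<open>The remainder in Taylor's formula of order \<open>n\<close> about the midpoint vanishes. Coefficients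
  rather than the degree are bounded so that \<open>n = 0\<close> is covered.\<close>

lemma polynomial_if_higher_deriv_zero:
  fixes f :: "real \<Rightarrow> real"
  assumes "a < b"
    and diff: "\<And>k x. k < n \<Longrightarrow> x \<in> {a<..<b} \<Longrightarrow> (deriv ^^ k) f field_differentiable (at x)"
    and zero: "\<And>x. x \<in> {a<..<b} \<Longrightarrow> (deriv ^^ n) f x = 0"
  obtains P where "\<And>i. i \<ge> n \<Longrightarrow> coeff P i = 0" "\<And>x. x \<in> {a<..<b} \<Longrightarrow> f x = poly P x"
proof -
  define c where "c = (a + b) / 2"
  have c: "a < c" "c < b" using \<open>a < b\<close> by (auto simp: c_def)
  define P where "P = (\<Sum>k<n. smult ((deriv ^^ k) f c / fact k) ([:- c, 1:] ^ k))"
  have "coeff P i = 0" if "i \<ge> n" for i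
    unfolding P_def coeff_sum
  proof (intro sum.neutral ballI)
    fix k assume "k \<in> {..<n}"
    then have "degree ([:- c, 1:] ^ k) < i"
      using that degree_power_le[of "[:- c, 1:]" k] by simp
    then show "coeff (smult ((deriv ^^ k) f c / fact k) ([:- c, 1:] ^ k)) i = 0"
      by (simp add: coeff_eq_0)
  qed
  moreover have "f x = poly P x" if x: "x \<in> {a<..<b}" for x
  proof -
    have eval: "poly P x = (\<Sum>k<n. (deriv ^^ k) f c / fact k * (x - c) ^ k)"
      by (simp add: P_def poly_sum poly_power)
    show ?thesis
    proof (cases "n = 0 \<or> x = c")
      case True
      show ?thesis
      proof (cases n)
        case 0
        then show ?thesis using zero x eval by simp
      next
        case (Suc m)
        with True have "x = c" by simp
        then show ?thesis using Suc unfolding eval by (simp add: sum.lessThan_Suc_shift)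
      qed
    next
      case False
      have "\<exists>t. (if x < c then x < t \<and> t < c else c < t \<and> t < x) \<and>
          f x = (\<Sum>k<n. (deriv ^^ k) f c / fact k * (x - c) ^ k)
            + (deriv ^^ n) f t / fact n * (x - c) ^ n"
      proof (rule Taylor[where a = "min x c" and b = "max x c"])
        show "\<forall>m t. m < n \<and> min x c \<le> t \<and> t \<le> max x c \<longrightarrow>
            ((deriv ^^ m) f has_real_derivative (deriv ^^ Suc m) f t) (at t)"
        proof (intro allI impI)
          fix m t assume *: "m < n \<and> min x c \<le> t \<and> t \<le> max x c"
          then have "t \<in> {a<..<b}" using x c by (auto simp: min_def max_def split: if_splits)
          with * diff show "((deriv ^^ m) f has_real_derivative (deriv ^^ Suc m) f t) (at t)"
            by (simp add: DERIV_deriv_iff_field_differentiable)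
        qed
      qed (use False in auto)
      then obtain t where "if x < c then x < t \<and> t < c else c < t \<and> t < x"
        and tay: "f x = (\<Sum>k<n. (deriv ^^ k) f c / fact k * (x - c) ^ k)
            + (deriv ^^ n) f t / fact n * (x - c) ^ n"
        by blast
      then have "t \<in> {a<..<b}" using x c by (auto split: if_splits)
      then show ?thesis using tay zero eval by simp
    qed
  qed
  ultimately show ?thesis by (rule that)
qed

text \<open>Differentiating lowers the multiplicity of a root by exactly one, so vanishing
  derivatives add up to a high multiplicity.\<close>

lemma power_dvd_if_pderivs_zero:
  fixes P :: "real poly"
  assumes "\<And>k. k < n \<Longrightarrow> poly ((pderiv ^^ k) P) c = 0"
  shows "[:- c, 1:] ^ n dvd P"
  using assms
proof (induction n arbitrary: P)
  case (Suc n)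
  have root: "poly P c = 0" using Suc.prems[of 0] by simp
  have "[:- c, 1:] ^ n dvd pderiv P"
    using Suc.prems[of "Suc _"] by (intro Suc.IH) (simp add: funpow_swap1)
  show ?case
  proof (cases "pderiv P = 0")
    case True
    then obtain e where "P = [:e:]" using pderiv_iszero by blast
    then show ?thesis using root by simp
  next
    case False
    then have "P \<noteq> 0" by auto
    then have "order c P = Suc (order c (pderiv P))"
      using root False by (intro order_pderiv) (auto simp: order_root)
    moreover have "n \<le> order c (pderiv P)"
      using \<open>[:- c, 1:] ^ n dvd pderiv P\<close> False by (simp add: order_divides)
    ultimately show ?thesis by (subst order_divides) simp
  qed
qed simp

text \<open>The difference has a zero of order \<open>n\<close> at each of two points, more zeros in total than its
  degree permits.\<close>

lemma two_point_hermite_unique: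
  fixes P Q :: "real poly"
  assumes "a \<noteq> b"
    and P: "\<And>i. i \<ge> 2 * n \<Longrightarrow> coeff P i = 0"
      "[:- a, 1:] ^ n dvd P - [:c:]" "[:- b, 1:] ^ n dvd P - [:d:]"
    and Q: "\<And>i. i \<ge> 2 * n \<Longrightarrow> coeff Q i = 0"
      "[:- a, 1:] ^ n dvd Q - [:c:]" "[:- b, 1:] ^ n dvd Q - [:d:]"
  shows "P = Q"
proof (rule ccontr)
  assume "P \<noteq> Q"
  let ?D = "P - Q"
  have "[:- a, 1:] ^ n dvd ?D" "[:- b, 1:] ^ n dvd ?D"
    using dvd_diff[OF P(2) Q(2)] dvd_diff[OF P(3) Q(3)] by simp_all
  then obtain E where E: "?D = [:- a, 1:] ^ n * E" by (elim dvdE)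
  \<comment> \<open>The first factor does not vanish at \<open>b\<close>, so all the multiplicity there comes from \<open>E\<close>.\<close>
  have "order b ([:- a, 1:] ^ n) = 0"
    using \<open>a \<noteq> b\<close> by (intro order_0I) (simp add: poly_power)
  then have "order b ?D = order b E"
    using \<open>P \<noteq> Q\<close> unfolding E by (subst order_mult) (auto simp flip: E)
  moreover have "n \<le> order b ?D"
    using \<open>[:- b, 1:] ^ n dvd ?D\<close> \<open>P \<noteq> Q\<close> by (simp add: order_divides)
  ultimately have "[:- b, 1:] ^ n dvd E" by (simp add: order_divides)
  then have "[:- a, 1:] ^ n * [:- b, 1:] ^ n dvd ?D"
    unfolding E by (rule mult_dvd_mono[OF dvd_refl])
  then have "degree ([:- a, 1:] ^ n * [:- b, 1:] ^ n) \<le> degree ?D"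
    using \<open>P \<noteq> Q\<close> by (intro dvd_imp_degree_le) auto
  then have "2 * n \<le> degree ?D"
    by (simp add: degree_mult_eq degree_power_eq)
  then have "lead_coeff ?D = 0" using P(1) Q(1) by simp
  then have "?D = 0" by (simp only: leading_coeff_0_iff)
  then show False using \<open>P \<noteq> Q\<close> by simp
qed

section \<open>The interpolating polynomials\<close>

text \<open>For \<open>t\<close> between \<open>0\<close> and \<open>1\<close>, and tosses with success probability \<open>t\<close>, the first summand is
  the probability that \<open>m + 1\<close> failures precede \<open>n + 1\<close> successes. When
  \<open>m\<close> grows by one, the probability that moves from the first to the second summand is that of
  completing \<open>n + 1\<close> successes with exactly \<open>m + 1\<close> failures before. Pascal's rule is the
  corresponding bookkeeping. The exponents are shifted to avoid truncated subtraction.\<close>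

lemma matchbox_identity:
  fixes t :: real
  shows "(1 - t) ^ Suc m * (\<Sum>l\<le>n. real ((l + m) choose l) * t ^ l) +
    t ^ Suc n * (\<Sum>l\<le>m. real ((l + n) choose l) * (1 - t) ^ l) = 1"
proof (induction m)
  case 0
  have "(1 - t) * (\<Sum>l\<le>n. t ^ l) = 1 - t ^ Suc n"
    by (simp add: sum_gp_basic)
  then show ?case by simp
next
  case (Suc m)
  let ?B = "\<lambda>m. \<Sum>l\<le>n. real ((l + m) choose l) * t ^ l"
  have "(1 - t) * ?B (Suc m) = ?B m - t ^ Suc n * real ((n + Suc m) choose n)"
  proof (induction n)
    case (Suc n)
    show ?case
      unfolding sum.atMost_Suc distrib_left Suc.IH by (simp add: algebra_simps)
  qed simp
  moreover have "(n + Suc m) choose n = (Suc m + n) choose Suc m"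
    by (metis add.commute binomial_symmetric add_diff_cancel_right' le_add2)
  moreover have "(1 - t) ^ Suc (Suc m) * ?B (Suc m) =
      (1 - t) ^ Suc m * ((1 - t) * ?B (Suc m))"
    by simp
  ultimately have "(1 - t) ^ Suc (Suc m) * ?B (Suc m) =
      (1 - t) ^ Suc m * (?B m - t ^ Suc n * real ((Suc m + n) choose Suc m))"
    by metis
  then show ?case using Suc.IH by (simp add: algebra_simps)
qed

text \<open>The pseudo-probability of exit at \<open>r\<close> rather than at \<open>s\<close>. Keeping the order of \<open>r\<close> and \<open>s\<close>
  open lets one definition serve both ends of the interval.\<close>

definition ruin_poly :: "nat \<Rightarrow> real \<Rightarrow> real \<Rightarrow> real poly" where
  "ruin_poly N r s = smult (1 / (r - s)) [:- s, 1:] ^ N *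
     (\<Sum>l=0..N - 1. smult (real ((l + N - 1) choose l)) (smult (1 / (s - r)) [:- r, 1:] ^ l))"

lemma poly_ruin_poly:
  "poly (ruin_poly N a b) x = H0_minus N a b x" "poly (ruin_poly N b a) x = H0_plus N a b x"
proof -
  \<comment> \<open>The left-hand side is what evaluating a linear factor coefficientwise produces.\<close>
  have lin: "1 / (s - r) * (- r + x * (1 + x * 0)) = (x - r) / (s - r)" for r s
    by simp
  have "(x - b) / (a - b) = (b - x) / (b - a)" by (metis minus_diff_eq minus_divide_divide)
  then show "poly (ruin_poly N a b) x = H0_minus N a b x"
    "poly (ruin_poly N b a) x = H0_plus N a b x"
    by (simp_all only: ruin_poly_def H0_minus_def H0_plus_def poly_mult poly_power poly_sum
        poly_smult poly_pCons poly_0 lin)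
qed

lemma power_dvd_ruin_poly: "[:- s, 1:] ^ N dvd ruin_poly N r s"
  unfolding ruin_poly_def smult_power by (intro dvd_mult2 dvd_smult dvd_refl)

lemma coeff_ruin_poly:
  assumes "N > 0" "i \<ge> 2 * N"
  shows "coeff (ruin_poly N r s) i = 0"
proof (rule coeff_eq_0)
  have lin: "degree (smult u [:v, 1:] ^ l) \<le> l" for u v :: real and l
    by (rule order_trans[OF degree_power_le]) (simp add: degree_pCons_eq_if)
  have "degree (ruin_poly N r s) \<le> N + (N - 1)"
    unfolding ruin_poly_def
  proof (intro order_trans[OF degree_mult_le] add_mono lin degree_sum_le)
    fix l assume "l \<in> {0..N - 1}"
    then show "degree (smult (real ((l + N - 1) choose l)) (smult (1 / (s - r)) [:- r, 1:] ^ l))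
        \<le> N - 1"
      using lin[of "1 / (s - r)" "- r" l] degree_smult_le order_trans
      by (metis atLeastAtMost_iff)
  qed simp
  then show "degree (ruin_poly N r s) < i" using assms by simp
qed

lemma ruin_poly_add:
  assumes "a \<noteq> b" "N > 0"
  shows "ruin_poly N a b + ruin_poly N b a = 1"
proof -
  obtain m where m: "N = Suc m" using \<open>N > 0\<close> gr0_implies_Suc by blast
  have "poly (ruin_poly N a b + ruin_poly N b a) x = poly 1 x" for x
  proof -
    define t where "t = (x - a) / (b - a)"
    have t: "(b - x) / (b - a) = 1 - t"
      using \<open>a \<noteq> b\<close> by (simp add: t_def field_simps)
    show ?thesis
      using matchbox_identity[of t m m]
      by (simp add: poly_ruin_poly[where a = a and b = b] H0_minus_def H0_plus_def t m
          atMost_atLeast0 flip: t_def)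
  qed
  then show ?thesis by (metis poly_eq_poly_eq_iff ext)
qed

text \<open>Writing \<open>c\<close> and \<open>d\<close> as multiples of the sum of the two ruin polynomials leaves, in each
  difference, only the one that vanishes to order \<open>N\<close> at the endpoint in question.\<close>

lemma hermite_interpolant:
  fixes a b c d :: real
  assumes "a \<noteq> b" "N > 0"
  defines "Q \<equiv> smult c (ruin_poly N a b) + smult d (ruin_poly N b a)"
  shows "[:- a, 1:] ^ N dvd Q - [:c:]" "[:- b, 1:] ^ N dvd Q - [:d:]"
proof -
  have one: "[:e:] = smult e (ruin_poly N a b) + smult e (ruin_poly N b a)" for e
    using ruin_poly_add[OF assms(1,2)] by (metis smult_add_right smult_one)
  have "Q - [:c:] = smult (d - c) (ruin_poly N b a)"
    unfolding one Q_def by (simp add: smult_diff_left)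
  then show "[:- a, 1:] ^ N dvd Q - [:c:]"
    by (simp add: dvd_smult power_dvd_ruin_poly)
  have "Q - [:d:] = smult (c - d) (ruin_poly N a b)"
    unfolding one Q_def by (simp add: smult_diff_left)
  then show "[:- b, 1:] ^ N dvd Q - [:d:]"
    by (simp add: dvd_smult power_dvd_ruin_poly)
qed

section \<open>The ruin probabilities\<close>

text \<open>One argument for both ends of the interval: \<open>F\<close> stands for the one-sided filter at \<open>r\<close>, and
  \<open>\<phi>\<close> contributes no derivatives of positive order because it is constant near \<open>r\<close>.\<close>

lemma boundary_contact:
  fixes P :: "real poly"
  assumes bd: "\<And>k. k < n \<Longrightarrow> ((deriv ^^ k) \<Psi> \<longlongrightarrow> (deriv ^^ k) \<phi> r) F"
    and P: "\<And>k. \<forall>\<^sub>F x in F. (deriv ^^ k) \<Psi> x = poly ((pderiv ^^ k) P) x"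
    and F: "F \<le> at r" "F \<noteq> bot"
    and U: "open U" "r \<in> U" "\<And>x. x \<in> U \<Longrightarrow> \<phi> x = c"
  shows "[:- r, 1:] ^ n dvd P - [:c:]"
proof (rule power_dvd_if_pderivs_zero)
  fix k assume "k < n"
  let ?P = "(pderiv ^^ k) P"
  have "(poly ?P \<longlongrightarrow> poly ?P r) F"
    using tendsto_mono[OF F(1) isContD[OF poly_isCont]] .
  moreover have "(poly ?P \<longlongrightarrow> (deriv ^^ k) \<phi> r) F"
    by (rule Lim_transform_eventually[OF bd[OF \<open>k < n\<close>] P])
  ultimately have "poly ?P r = (deriv ^^ k) \<phi> r"
    using F(2) tendsto_unique by blast
  moreover have "(deriv ^^ k) \<phi> r = poly ((pderiv ^^ k) [:c:]) r"
    by (rule higher_deriv_eq_poly[OF U(1) _ U(2)]) (simp add: U(3))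
  moreover have "(pderiv ^^ k) (P - [:c:]) = ?P - (pderiv ^^ k) [:c:]"
    by (induction k) (simp_all add: pderiv_diff)
  ultimately show "poly ((pderiv ^^ k) (P - [:c:])) r = 0"
    by simp
qed

text \<open>Arbitrary cutoff values \<open>c\<close>, \<open>d\<close> cover exit on the left and exit on the right at once.\<close>

lemma cutoff_bvp_solution:
  assumes "N > 0" "a < b" and cut: "smooth_cutoff a b c d \<phi>"
    and bvp: "solves_exit_bvp N a b \<phi> \<Psi>" and x: "x \<in> {a<..<b}"
  shows "\<Psi> x = c * H0_minus N a b x + d * H0_plus N a b x"
proof -
  obtain P where deg: "\<And>i. i \<ge> 2 * N \<Longrightarrow> coeff P i = 0"
    and P: "\<And>x. x \<in> {a<..<b} \<Longrightarrow> \<Psi> x = poly P x"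
    using bvp unfolding solves_exit_bvp_def
    by (metis polynomial_if_higher_deriv_zero[OF \<open>a < b\<close>])
  have der: "(deriv ^^ k) \<Psi> x = poly ((pderiv ^^ k) P) x" if "x \<in> {a<..<b}" for k x
    by (rule higher_deriv_eq_poly[of "{a<..<b}"]) (use that P in auto)
  obtain U V where U: "open U" "{..a} \<subseteq> U" "\<forall>x\<in>U. \<phi> x = c"
    and V: "open V" "{b..} \<subseteq> V" "\<forall>x\<in>V. \<phi> x = d"
    using cut unfolding smooth_cutoff_def by blast
  have "[:- a, 1:] ^ N dvd P - [:c:]"
  proof (rule boundary_contact[where F = "at_right a" and U = U])
    show "((deriv ^^ k) \<Psi> \<longlongrightarrow> (deriv ^^ k) \<phi> a) (at_right a)" if "k < N" for k
      using bvp that unfolding solves_exit_bvp_def by simp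
    show "\<forall>\<^sub>F x in at_right a. (deriv ^^ k) \<Psi> x = poly ((pderiv ^^ k) P) x" for k
      using eventually_at_right_real[OF \<open>a < b\<close>] by (rule eventually_mono) (rule der)
  qed (use U in \<open>auto intro: at_le\<close>)
  moreover have "[:- b, 1:] ^ N dvd P - [:d:]"
  proof (rule boundary_contact[where F = "at_left b" and U = V])
    show "((deriv ^^ k) \<Psi> \<longlongrightarrow> (deriv ^^ k) \<phi> b) (at_left b)" if "k < N" for k
      using bvp that unfolding solves_exit_bvp_def by simp
    show "\<forall>\<^sub>F x in at_left b. (deriv ^^ k) \<Psi> x = poly ((pderiv ^^ k) P) x" for k
      using eventually_at_left_real[OF \<open>a < b\<close>] by (rule eventually_mono) (rule der)
  qed (use V in \<open>auto intro: at_le\<close>)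
  ultimately have "P = smult c (ruin_poly N a b) + smult d (ruin_poly N b a)"
    using assms(1,2) deg
    by (intro two_point_hermite_unique[of a b N _ c d] hermite_interpolant)
      (auto simp: coeff_ruin_poly)
  then show ?thesis using P[OF x] by (simp add: poly_ruin_poly[where a = a and b = b])
qed

theorem corollary3:
  fixes N :: nat and a b :: real and p :: "real \<Rightarrow> real \<Rightarrow> real"
  assumes "N \<ge> 2" and "a < b"
    and "pseudo_brownian_kernel N p"
    and "\<And>\<phi>. smooth_fun \<phi> \<Longrightarrow> bounded (range \<phi>) \<Longrightarrow>
           \<exists>\<Psi>. (\<forall>x\<in>{a<..<b}. has_exit_expectation p a b \<phi> x (\<Psi> x)) \<and>
               solves_exit_bvp N a b \<phi> \<Psi>"
  shows "\<forall>x\<in>{a<..<b}. has_lower_ruin_prob p a b x (H0_minus N a b x) \<and>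
                      has_upper_ruin_prob p a b x (H0_plus N a b x)"
proof -
  have "has_exit_expectation p a b \<phi> x (c * H0_minus N a b x + d * H0_plus N a b x)"
    if cut: "smooth_cutoff a b c d \<phi>" and x: "x \<in> {a<..<b}" for c d \<phi> x
  proof -
    obtain \<Psi> where \<Psi>: "\<forall>x\<in>{a<..<b}. has_exit_expectation p a b \<phi> x (\<Psi> x)"
      "solves_exit_bvp N a b \<phi> \<Psi>"
      using assms(4) cut smooth_cutoff_bounded[OF cut] unfolding smooth_cutoff_def by blast
    then show ?thesis
      using cutoff_bvp_solution[OF _ \<open>a < b\<close> cut \<Psi>(2) x] x \<open>N \<ge> 2\<close> by force
  qed
  from this[of 1 0] this[of 0 1] show ?thesis
    unfolding has_lower_ruin_prob_def has_upper_ruin_prob_def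
    using smooth_cutoff_exists[OF \<open>a < b\<close>] by simp
qed

end
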